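(* Let $X_1,\dots,X_n$ be random variables on a common probability space, and let $\alpha_1,\dots,\alpha_n\ge 0$, $r>0$ and $K>0$ be real numbers. Assume that for all $k,m$ with $1\le k\le m\le n$ $$\mathbb{E}\Big[\max_{k\le l\le m}|X_k+\dots+X_l|\Big]^r\le K\sum_{l=k}^m\alpha_l .$$ Then for every non-decreasing sequence $\beta_1\le\dots\le\beta_n$ of positive numbers and every $m$ with $1\le m\le n$ $$\mathbb{E}\left[\max_{m\le l\le n}\left|\frac{S_l}{\beta_l}\right|\right]^r\le C\left[\frac{1}{\beta_m^r}\sum_{l=1}^m\alpha_l+\sum_{l=m+1}^n\frac{\alpha_l}{\beta_l^r}\right]$$ with $C=4D_rK$, where $D_r=1$ for $0<r\le 1$ and $D_r=2^{r-1}$ for $r\ge 1$.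
   Context: $S_l=X_1+\dots+X_l$ denotes the partial sums. $\mathbb{E}[Y]^r$ means $\mathbb{E}(Y^r)$, the expectation of the $r$-th power. No assumption is made on the dependence structure of the random variables. An empty sum equals $0$. *)

theory Defs
  imports "HOL-Probability.Probability"
begin

definition partial_sum :: "(nat \<Rightarrow> 'a \<Rightarrow> real) \<Rightarrow> nat \<Rightarrow> 'a \<Rightarrow> real" where
  "partial_sum X l \<omega> = (\<Sum>i=1..l. X i \<omega>)"

text \<open>
  The expectation of the r-th power of a nonnegative random variable, as an extended
  nonnegative real. The Bochner integral is not used because it is 0 for non-integrable
  functions; here a bound by a finite number includes integrability.
\<close>
definition moment :: "'a measure \<Rightarrow> real \<Rightarrow> ('a \<Rightarrow> real) \<Rightarrow> ennreal" where
  "moment M r Y = (\<integral>\<^sup>+ \<omega>. ennreal (Y \<omega> powr r) \<partial>M)"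

definition D_const :: "real \<Rightarrow> real" where
  "D_const r = (if r \<le> 1 then 1 else 2 powr (r - 1))"

end

theory Submission imports Defs begin

text \<open>
  Let \<open>c\<^sub>k = \<beta>\<^sub>k\<^sup>-\<^sup>r\<close> for \<open>k \<le> n\<close> and \<open>c\<^sub>n\<^sub>+\<^sub>1 = 0\<close>, a non-increasing sequence, and let \<open>T\<^sub>k\<close> be the
  \<open>r\<close>-th power of the maximum of \<open>\<bar>S\<^sub>1\<bar>, \<dots>, \<bar>S\<^sub>k\<bar>\<close>, which is non-decreasing in \<open>k\<close>. Pointwise,
  \<open>c\<^sub>l T\<^sub>l \<le> \<Sum>\<^sub>k (c\<^sub>k - c\<^sub>k\<^sub>+\<^sub>1) T\<^sub>k\<close> with \<open>k\<close> from \<open>m\<close> to \<open>n\<close>, for every \<open>l\<close> in this range, since the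
  sum over \<open>k \<ge> l\<close> of the nonnegative weights telescopes to \<open>c\<^sub>l\<close>. Taking expectations and summing
  by parts gives the bound with constant \<open>K \<le> 4 D\<^sub>r K\<close>.
\<close>

text \<open>Abel summation, used twice: for the pointwise bound and for evaluating \<open>B\<close>.
  In both uses \<open>c (Suc n) = 0\<close> removes the last boundary term.\<close>

lemma sum_by_parts_decreasing_weights:
  fixes c f :: "nat \<Rightarrow> real"
  assumes "m \<le> n"
  shows "(\<Sum>k=m..n. (c k - c (Suc k)) * f k) =
    c m * f m + (\<Sum>k=m+1..n. c k * (f k - f (k - 1))) - c (Suc n) * f n"
  using assms by (induction n rule: dec_induct) (auto simp: algebra_simps)

text \<open>Summing by parts from \<open>l\<close> instead of \<open>m\<close> leaves
  \<open>c l * f l\<close> plus nonnegative increments of \<open>f\<close>; the omitted terms with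
  \<open>k < l\<close> are nonnegative because \<open>c\<close> decreases.\<close>

lemma weighted_le_sum_by_parts:
  fixes c f :: "nat \<Rightarrow> real"
  assumes "l \<in> {m..n}" "c (Suc n) = 0"
    and c_nonneg: "\<And>k. k \<in> {m..n} \<Longrightarrow> 0 \<le> c k"
    and c_decreasing: "\<And>k. k \<in> {m..n} \<Longrightarrow> c (Suc k) \<le> c k"
    and f_nonneg: "\<And>k. k \<in> {m..n} \<Longrightarrow> 0 \<le> f k"
    and f_mono: "mono_on {m..n} f"
  shows "c l * f l \<le> (\<Sum>k=m..n. (c k - c (Suc k)) * f k)"
proof -
  have "0 \<le> (\<Sum>k=l+1..n. c k * (f k - f (k - 1)))"
    using assms(1) c_nonneg by (intro sum_nonneg mult_nonneg_nonneg) (auto intro!: mono_onD[OF f_mono])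
  then have "c l * f l \<le> (\<Sum>k=l..n. (c k - c (Suc k)) * f k)"
    using assms(1,2) sum_by_parts_decreasing_weights[of l n c f] by simp
  also have "\<dots> \<le> (\<Sum>k=m..n. (c k - c (Suc k)) * f k)"
    using assms(1) c_decreasing f_nonneg by (intro sum_mono2) auto
  finally show ?thesis .
qed

theorem theorem2p3:
  fixes M :: "'a measure" and X :: "nat \<Rightarrow> 'a \<Rightarrow> real"
    and \<alpha> \<beta> :: "nat \<Rightarrow> real" and r K :: real and n m :: nat
  assumes "prob_space M"
    and "\<And>i. i \<in> {1..n} \<Longrightarrow> X i \<in> borel_measurable M"
    and "\<And>i. i \<in> {1..n} \<Longrightarrow> \<alpha> i \<ge> 0"
    and "r > 0" and "K > 0"
    and "\<And>k m. 1 \<le> k \<Longrightarrow> k \<le> m \<Longrightarrow> m \<le> n \<Longrightarrow>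
      moment M r (\<lambda>\<omega>. MAX l\<in>{k..m}. \<bar>\<Sum>i=k..l. X i \<omega>\<bar>) \<le> ennreal (K * (\<Sum>l=k..m. \<alpha> l))"
    and "mono_on {1..n} \<beta>"
    and "\<And>i. i \<in> {1..n} \<Longrightarrow> \<beta> i > 0"
    and "1 \<le> m" and "m \<le> n"
  shows "moment M r (\<lambda>\<omega>. MAX l\<in>{m..n}. \<bar>partial_sum X l \<omega> / \<beta> l\<bar>)
    \<le> ennreal (4 * D_const r * K *
        (1 / \<beta> m powr r * (\<Sum>l=1..m. \<alpha> l) + (\<Sum>l=m+1..n. \<alpha> l / \<beta> l powr r)))"
proof -
  define c where "c k = (if k \<le> n then 1 / \<beta> k powr r else 0)" for k
  define P where "P k \<omega> = (MAX l\<in>{1..k}. \<bar>partial_sum X l \<omega>\<bar>)" for k \<omega>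
  define A where "A k = (\<Sum>l=1..k. \<alpha> l)" for k
  \<comment> \<open>\<open>B\<close> is the bracket of the claim before summation by parts; this
    form shows its sign and is what integration produces.\<close>
  define B where "B = (\<Sum>k=m..n. (c k - c (Suc k)) * A k)"
  have c_nonneg: "0 \<le> c k" for k
    by (simp add: c_def)
  \<comment> \<open>For \<open>k = n\<close> this is the cutoff \<open>c (Suc n) = 0\<close>;
    nothing is known about \<open>\<beta>\<close> beyond \<open>n\<close>.\<close>
  have c_decreasing: "c (Suc k) \<le> c k" if "k \<in> {m..n}" for k
  proof -
    have "\<beta> k powr r \<le> \<beta> (Suc k) powr r" if "Suc k \<le> n"
      using \<open>k \<in> {m..n}\<close> that assms(4,8,9)
      by (intro powr_mono2 mono_onD[OF assms(7)]) (auto simp: less_imp_le)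
    then show ?thesis
      using assms(8)[of k] that assms(9) by (auto simp: c_def intro!: frac_le)
  qed
  have A_nonneg: "0 \<le> A k" if "k \<in> {m..n}" for k
    unfolding A_def using that assms(3) by (intro sum_nonneg) auto
  have B_nonneg: "0 \<le> B"
    unfolding B_def using c_decreasing A_nonneg
    by (intro sum_nonneg mult_nonneg_nonneg) auto
  have P_ge: "\<bar>partial_sum X l \<omega>\<bar> \<le> P k \<omega>" if "l \<in> {1..k}" for l k \<omega>
    unfolding P_def using that by (intro Max_ge) auto
  have P_nonneg: "0 \<le> P k \<omega>" if "k \<in> {m..n}" for k \<omega>
    using P_ge[of 1 k \<omega>] that assms(9) by auto
  have P_mono: "mono_on {m..n} (\<lambda>k. P k \<omega> powr r)" for \<omega>
  proof (rule mono_onI)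
    fix j k assume "j \<in> {m..n}" "k \<in> {m..n}" "j \<le> k"
    moreover from this have "P j \<omega> \<le> P k \<omega>"
      unfolding P_def using assms(9) by (intro Max_mono) auto
    ultimately show "P j \<omega> powr r \<le> P k \<omega> powr r"
      using P_nonneg assms(4) by (intro powr_mono2) auto
  qed
  have P_measurable: "P k \<in> borel_measurable M" if "k \<in> {m..n}" for k
  proof -
    have "(\<lambda>\<omega>. \<bar>partial_sum X l \<omega>\<bar>) \<in> borel_measurable M" if "l \<in> {1..k}" for l
      unfolding partial_sum_def using that \<open>k \<in> {m..n}\<close>
      by (intro borel_measurable_abs borel_measurable_sum assms(2)) auto
    then show ?thesis
      unfolding P_def by (intro borel_measurable_Max) auto
  qed
  \<comment> \<open>The moment hypothesis for blocks starting at index 1, which are the partial sums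
    themselves.\<close>
  have P_moment: "(\<integral>\<^sup>+ \<omega>. ennreal (P k \<omega> powr r) \<partial>M) \<le> ennreal (K * A k)" if "k \<in> {m..n}" for k
    using assms(6)[of 1 k] that assms(9)
    by (simp add: moment_def P_def A_def partial_sum_def)
  have pointwise: "(MAX l\<in>{m..n}. \<bar>partial_sum X l \<omega> / \<beta> l\<bar>) powr r
      \<le> (\<Sum>k=m..n. (c k - c (Suc k)) * P k \<omega> powr r)" for \<omega>
  proof -
    \<comment> \<open>The maximum is attained at some \<open>l\<close> depending on
      \<open>\<omega>\<close>, while the bound below is the same for every \<open>l\<close>.\<close>
    have "(MAX l\<in>{m..n}. \<bar>partial_sum X l \<omega> / \<beta> l\<bar>) \<in> (\<lambda>l. \<bar>partial_sum X l \<omega> / \<beta> l\<bar>) ` {m..n}"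
      using assms(10) by (intro Max_in) auto
    then obtain l where l: "l \<in> {m..n}"
      and eq: "(MAX l\<in>{m..n}. \<bar>partial_sum X l \<omega> / \<beta> l\<bar>) = \<bar>partial_sum X l \<omega> / \<beta> l\<bar>"
      by auto
    have "\<beta> l > 0" using l assms(8,9) by auto
    then have "\<bar>partial_sum X l \<omega> / \<beta> l\<bar> powr r = c l * \<bar>partial_sum X l \<omega>\<bar> powr r"
      using l by (simp add: c_def powr_divide abs_divide)
    also have "\<dots> \<le> c l * P l \<omega> powr r"
      using l assms(4,9) by (intro mult_left_mono powr_mono2 P_ge c_nonneg) auto
    also have "\<dots> \<le> (\<Sum>k=m..n. (c k - c (Suc k)) * P k \<omega> powr r)"
      using l c_nonneg c_decreasing P_mono
      by (intro weighted_le_sum_by_parts) (auto simp: c_def)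
    finally show ?thesis by (simp only: eq)
  qed
  \<comment> \<open>Coercing weights and powers separately lets the nonnegative integral split by
    linearity, with measurability of \<open>P k\<close> sufficing.\<close>
  have "moment M r (\<lambda>\<omega>. MAX l\<in>{m..n}. \<bar>partial_sum X l \<omega> / \<beta> l\<bar>)
      \<le> (\<integral>\<^sup>+ \<omega>. (\<Sum>k=m..n. ennreal (c k - c (Suc k)) * ennreal (P k \<omega> powr r)) \<partial>M)"
    unfolding moment_def
  proof (intro nn_integral_mono)
    fix \<omega>
    have "(\<Sum>k=m..n. ennreal (c k - c (Suc k)) * ennreal (P k \<omega> powr r))
        = ennreal (\<Sum>k=m..n. (c k - c (Suc k)) * P k \<omega> powr r)"
      using c_decreasing by (subst sum_ennreal[symmetric]) (auto intro!: sum.cong simp: ennreal_mult)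
    then show "ennreal ((MAX l\<in>{m..n}. \<bar>partial_sum X l \<omega> / \<beta> l\<bar>) powr r)
        \<le> (\<Sum>k=m..n. ennreal (c k - c (Suc k)) * ennreal (P k \<omega> powr r))"
      using pointwise by (simp add: ennreal_leI)
  qed
  also have "\<dots> = (\<Sum>k=m..n. ennreal (c k - c (Suc k)) * (\<integral>\<^sup>+ \<omega>. ennreal (P k \<omega> powr r) \<partial>M))"
    using P_measurable by (subst nn_integral_sum) (auto intro!: sum.cong nn_integral_cmult)
  also have "\<dots> \<le> (\<Sum>k=m..n. ennreal (c k - c (Suc k)) * ennreal (K * A k))"
    using P_moment by (intro sum_mono mult_left_mono) auto
  also have "\<dots> = ennreal (\<Sum>k=m..n. (c k - c (Suc k)) * (K * A k))"
    using c_decreasing A_nonneg assms(5)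
    by (subst sum_ennreal[symmetric]) (auto intro!: sum.cong simp: ennreal_mult)
  also have "\<dots> = ennreal (K * B)"
    by (simp add: B_def sum_distrib_left mult.left_commute)
  \<comment> \<open>Pure weakening of the constant \<open>K\<close>: \<open>D_const r\<close> is at
    least 1 and \<open>K * B\<close> is nonnegative.\<close>
  also have "\<dots> \<le> ennreal (4 * D_const r * K * B)"
  proof -
    have "1 \<le> D_const r"
      by (simp add: D_const_def ge_one_powr_ge_zero)
    then show ?thesis
      using assms(5) B_nonneg mult_right_mono[of 1 "4 * D_const r" "K * B"]
      by (intro ennreal_leI) (simp add: mult.assoc)
  qed
  also have "B = 1 / \<beta> m powr r * (\<Sum>l=1..m. \<alpha> l) + (\<Sum>l=m+1..n. \<alpha> l / \<beta> l powr r)"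
  proof -
    \<comment> \<open>Here \<open>k\<close> is positive, so \<open>k - 1\<close> is not
      truncated.\<close>
    have "A k - A (k - 1) = \<alpha> k" if "k \<in> {m+1..n}" for k
      using that by (cases k) (auto simp: A_def)
    then have "(\<Sum>k=m+1..n. c k * (A k - A (k - 1))) = (\<Sum>l=m+1..n. \<alpha> l / \<beta> l powr r)"
      by (intro sum.cong) (auto simp: c_def)
    then show ?thesis
      using sum_by_parts_decreasing_weights[OF assms(10), of c A] assms(10)
      unfolding B_def by (simp add: c_def A_def)
  qed
  finally show ?thesis .
qed

end
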